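(* Let $\epsilon\in\{1,-1\}$ and let $Q,V,H,J$ be real constants with $Q\neq 0$ and $V-\epsilon H\neq 0$. On $\mathbb{R}^3$ with coordinates $u=(u_1,u_2,u_3)$ let $\widetilde G$ be the symmetric tensor with components $$\widetilde G_{11}=\widetilde G_{22}=Q e^{-2\epsilon u_3},\qquad \widetilde G_{12}=\widetilde G_{21}=\epsilon Q e^{-2\epsilon u_3},$$ $$\widetilde G_{13}=\widetilde G_{31}=V\cosh u_3-H\sinh u_3+Q\frac{\epsilon V-H}{2}u_3e^{-u_3},$$ $$\widetilde G_{23}=\widetilde G_{32}=H\cosh u_3-V\sinh u_3+Q\frac{V-\epsilon H}{2}u_3e^{-u_3},$$ $$\widetilde G_{33}=J-Q(V-\epsilon H)^2u_3^2 .$$ Then the pseudo-Riemannian metric $\widetilde G$ has nonvanishing Ricci tensor and zero scalar curvature. Moreover, let $c_0,c_1,c_2,c_3$ be real constants with $v c_2^2+2q c_1c_3=0$, where $q=Q^{-1}$, $v=V-\epsilon H$, and consider the Poisson--Lie transformed dilaton $$\Phi_U(y)=-2y_1+c_1e^{-y_1}+c_2\Big(\frac{v}{q}\big(y_1+e^{-y_1}\big)+e^{-y_1}y_2\Big)+c_3\Big(\frac{v}{q}(y_1-\sinh y_1)+\frac{q}{2v}e^{-y_1}y_2^2+\big(e^{-y_1}+y_1-1\big)y_2+y_3\Big)+c_0$$ with $y=(y_1,y_2,y_3)$ expressed through $u$ and the auxiliary variables $\tilde u=(\tilde u_1,\tilde u_2,\tilde u_3)\in\mathbb{R}^3$ by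 $$y_1=-\epsilon u_3,\qquad y_2=-\frac{\epsilon\tilde u_1+\tilde u_2}{2},\qquad y_3=\frac{-\epsilon u_1+u_2}{2}+\beta u_3,$$ where $\alpha=-\frac{\epsilon V+H}{2Q}$ and $\beta=\epsilon\frac{\alpha^2Q-J}{2v}$. Then $\Phi_U(y(u,\tilde u))$ is independent of $\tilde u$ if and only if $c_2=c_3=0$; in that case it equals $$\widetilde\Phi(u)=2\epsilon u_3+c_1e^{\epsilon u_3}+c_0,$$ and, for all real $c_0,c_1$, the pair $(\widetilde G,\widetilde\Phi)$ (with vanishing torsion) satisfies the vanishing $\beta$ equations.
   Context: The vanishing $\beta$ equations for a metric $G_{ij}$, a dilaton (smooth function) $\Phi$ and a torsion 3-form $H_{ijk}$ (not to be confused with the real constant $H$) are $$0=R_{ij}-\nabla_i\nabla_j\Phi-\tfrac14 H_{imn}H_j{}^{mn},$$ $$0=H_{kij}\nabla^k\Phi+\nabla^kH_{kij},$$ $$0=R-2\nabla_k\nabla^k\Phi-\nabla_k\Phi\nabla^k\Phi-\tfrac1{12}H_{kmn}H^{kmn}.$$ Here $\nabla$ is the Levi-Civita connection of $G$, $R_{ij}$ its Ricci tensor (usual sign convention, in which round spheres have positive Ricci curvature), $R$ its scalar curvature (called Gauss curvature in the paper), and indices are raised and lowered with $G$. With vanishing torsion, $H_{ijk}=0$, they reduce to $R_{ij}=\nabla_i\nabla_j\Phi$ and $R-2\nabla_k\nabla^k\Phi-\nabla_k\Phi\nabla^k\Phi=0$. The coordinates $y$ are coordinates on the group of a flat sigma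 model (Manin triple $(4|1)$), $u$ are coordinates on the group of the transformed model (Manin triple $(6_0|2)$ of the same Drinfel'd double), and $\tilde u$ are coordinates on the dual (auxiliary) group of the transformed model. A transformed dilaton is admissible only if it does not depend on $\tilde u$. *)

theory Defs
  imports "HOL-Analysis.Analysis"
begin

text \<open>Tensor fields on \<open>\<real>\<^sup>n\<close> are given by their components with respect to the
  standard coordinates.\<close>

definition pd :: "'n::finite \<Rightarrow> (real^'n \<Rightarrow> real) \<Rightarrow> real^'n \<Rightarrow> real" where
  "pd i f u = frechet_derivative f (at u) (axis i 1)"

primrec Ck :: "nat \<Rightarrow> (real^'n::finite \<Rightarrow> real) \<Rightarrow> bool" where
  "Ck 0 f \<longleftrightarrow> continuous_on UNIV f"
| "Ck (Suc k) f \<longleftrightarrow> f differentiable_on UNIV \<and> (\<forall>i. Ck k (pd i f))"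

definition smooth :: "(real^'n::finite \<Rightarrow> real) \<Rightarrow> bool" where
  "smooth f \<longleftrightarrow> (\<forall>k. Ck k f)"

text \<open>No condition on the signature is needed: it is locally constant for a continuous
  nondegenerate symmetric form, and the domain is connected.\<close>

definition pseudo_riemannian_metric :: "(real^'n::finite \<Rightarrow> real^'n^'n) \<Rightarrow> bool" where
  "pseudo_riemannian_metric G \<longleftrightarrow>
     (\<forall>i j. smooth (\<lambda>u. G u $ i $ j)) \<and>
     (\<forall>u. transpose (G u) = G u) \<and>
     (\<forall>u. invertible (G u))"

definition ginv :: "(real^'n::finite \<Rightarrow> real^'n^'n) \<Rightarrow> 'n \<Rightarrow> 'n \<Rightarrow> real^'n \<Rightarrow> real" where
  "ginv G i j u = matrix_inv (G u) $ i $ j"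

text \<open>\<open>christoffel G k i j\<close> is \<open>\<Gamma>\<^sup>k\<^sub>i\<^sub>j\<close> of the Levi-Civita connection.\<close>

definition christoffel ::
    "(real^'n::finite \<Rightarrow> real^'n^'n) \<Rightarrow> 'n \<Rightarrow> 'n \<Rightarrow> 'n \<Rightarrow> real^'n \<Rightarrow> real" where
  "christoffel G k i j u =
     (1/2) * (\<Sum>l\<in>UNIV. ginv G k l u *
        (pd i (\<lambda>x. G x $ l $ j) u + pd j (\<lambda>x. G x $ l $ i) u - pd l (\<lambda>x. G x $ i $ j) u))"

text \<open>\<open>riemann G k l i j\<close> is the \<open>k\<close>-th component of
  \<open>\<nabla>\<^sub>i \<nabla>\<^sub>j e\<^sub>l - \<nabla>\<^sub>j \<nabla>\<^sub>i e\<^sub>l\<close>. With this sign, contracting \<open>k\<close> with \<open>i\<close> gives round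
  spheres positive Ricci curvature.\<close>

definition riemann ::
    "(real^'n::finite \<Rightarrow> real^'n^'n) \<Rightarrow> 'n \<Rightarrow> 'n \<Rightarrow> 'n \<Rightarrow> 'n \<Rightarrow> real^'n \<Rightarrow> real" where
  "riemann G k l i j u =
     pd i (christoffel G k j l) u - pd j (christoffel G k i l) u
     + (\<Sum>m\<in>UNIV. christoffel G k i m u * christoffel G m j l u
                 - christoffel G k j m u * christoffel G m i l u)"

definition ricci ::
    "(real^'n::finite \<Rightarrow> real^'n^'n) \<Rightarrow> 'n \<Rightarrow> 'n \<Rightarrow> real^'n \<Rightarrow> real" where
  "ricci G i j u = (\<Sum>k\<in>UNIV. riemann G k i k j u)"

definition scalar_curvature :: "(real^'n::finite \<Rightarrow> real^'n^'n) \<Rightarrow> real^'n \<Rightarrow> real" where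
  "scalar_curvature G u = (\<Sum>i\<in>UNIV. \<Sum>j\<in>UNIV. ginv G i j u * ricci G i j u)"

text \<open>\<open>hess G \<Phi> i j\<close> is \<open>\<nabla>\<^sub>i \<nabla>\<^sub>j \<Phi>\<close>.\<close>

definition hess ::
    "(real^'n::finite \<Rightarrow> real^'n^'n) \<Rightarrow> (real^'n \<Rightarrow> real) \<Rightarrow> 'n \<Rightarrow> 'n \<Rightarrow> real^'n \<Rightarrow> real" where
  "hess G \<Phi> i j u = pd i (pd j \<Phi>) u - (\<Sum>k\<in>UNIV. christoffel G k i j u * pd k \<Phi> u)"

definition three_form :: "('n::finite \<Rightarrow> 'n \<Rightarrow> 'n \<Rightarrow> real^'n \<Rightarrow> real) \<Rightarrow> bool" where
  "three_form T \<longleftrightarrow>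
     (\<forall>i j k. smooth (T i j k)) \<and>
     (\<forall>i j k u. T j i k u = - T i j k u \<and> T i k j u = - T i j k u)"

text \<open>\<open>cov3 G T l k i j\<close> is \<open>\<nabla>\<^sub>l T\<^sub>k\<^sub>i\<^sub>j\<close>.\<close>

definition cov3 ::
    "(real^'n::finite \<Rightarrow> real^'n^'n) \<Rightarrow> ('n \<Rightarrow> 'n \<Rightarrow> 'n \<Rightarrow> real^'n \<Rightarrow> real) \<Rightarrow>
     'n \<Rightarrow> 'n \<Rightarrow> 'n \<Rightarrow> 'n \<Rightarrow> real^'n \<Rightarrow> real" where
  "cov3 G T l k i j u = pd l (T k i j) u
     - (\<Sum>m\<in>UNIV. christoffel G m l k u * T m i j u
                 + christoffel G m l i u * T k m j u
                 + christoffel G m l j u * T k i m u)"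

definition beta_equations ::
    "(real^'n::finite \<Rightarrow> real^'n^'n) \<Rightarrow> (real^'n \<Rightarrow> real) \<Rightarrow>
     ('n \<Rightarrow> 'n \<Rightarrow> 'n \<Rightarrow> real^'n \<Rightarrow> real) \<Rightarrow> bool" where
  "beta_equations G \<Phi> T \<longleftrightarrow>
     pseudo_riemannian_metric G \<and> smooth \<Phi> \<and> three_form T \<and>
     (\<forall>u i j. 0 = ricci G i j u - hess G \<Phi> i j u
        - (1/4) * (\<Sum>m\<in>UNIV. \<Sum>n\<in>UNIV. \<Sum>p\<in>UNIV. \<Sum>q\<in>UNIV.
            ginv G m p u * ginv G n q u * T i m n u * T j p q u)) \<and>
     (\<forall>u i j. 0 = (\<Sum>k\<in>UNIV. \<Sum>l\<in>UNIV. ginv G k l u * T k i j u * pd l \<Phi> u)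
        + (\<Sum>k\<in>UNIV. \<Sum>l\<in>UNIV. ginv G k l u * cov3 G T l k i j u)) \<and>
     (\<forall>u. 0 = scalar_curvature G u
        - 2 * (\<Sum>k\<in>UNIV. \<Sum>l\<in>UNIV. ginv G k l u * hess G \<Phi> k l u)
        - (\<Sum>k\<in>UNIV. \<Sum>l\<in>UNIV. ginv G k l u * pd k \<Phi> u * pd l \<Phi> u)
        - (1/12) * (\<Sum>k\<in>UNIV. \<Sum>m\<in>UNIV. \<Sum>n\<in>UNIV. \<Sum>l\<in>UNIV. \<Sum>p\<in>UNIV. \<Sum>q\<in>UNIV.
            ginv G k l u * ginv G m p u * ginv G n q u * T k m n u * T l p q u))"

definition G_tilde :: "real \<Rightarrow> real \<Rightarrow> real \<Rightarrow> real \<Rightarrow> real \<Rightarrow> real^3 \<Rightarrow> real^3^3" where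
  "G_tilde \<epsilon> Q V H J u =
     (let g11 = Q * exp (-2 * \<epsilon> * u$3);
          g12 = \<epsilon> * Q * exp (-2 * \<epsilon> * u$3);
          g13 = V * cosh (u$3) - H * sinh (u$3) + Q * ((\<epsilon> * V - H) / 2) * u$3 * exp (- (u$3));
          g23 = H * cosh (u$3) - V * sinh (u$3) + Q * ((V - \<epsilon> * H) / 2) * u$3 * exp (- (u$3));
          g33 = J - Q * (V - \<epsilon> * H)^2 * (u$3)^2
      in vector [vector [g11, g12, g13],
                 vector [g12, g11, g23],
                 vector [g13, g23, g33]])"

definition Phi_U ::
    "real \<Rightarrow> real \<Rightarrow> real \<Rightarrow> real \<Rightarrow> real \<Rightarrow> real \<Rightarrow> real^3 \<Rightarrow> real" where
  "Phi_U q v c0 c1 c2 c3 y =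
     - 2 * y$1 + c1 * exp (- (y$1))
     + c2 * ((v / q) * (y$1 + exp (- (y$1))) + exp (- (y$1)) * y$2)
     + c3 * ((v / q) * (y$1 - sinh (y$1)) + (q / (2 * v)) * exp (- (y$1)) * (y$2)^2
             + (exp (- (y$1)) + y$1 - 1) * y$2 + y$3)
     + c0"

text \<open>\<open>w\<close> stands for the auxiliary coordinates (u-tilde).\<close>

definition y_coords ::
    "real \<Rightarrow> real \<Rightarrow> real \<Rightarrow> real \<Rightarrow> real \<Rightarrow> real^3 \<Rightarrow> real^3 \<Rightarrow> real^3" where
  "y_coords \<epsilon> Q V H J u w =
     (let v = V - \<epsilon> * H;
          \<alpha> = - ((\<epsilon> * V + H) / (2 * Q));
          \<beta> = \<epsilon> * ((\<alpha>^2 * Q - J) / (2 * v))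
      in vector [- \<epsilon> * u$3,
                 - ((\<epsilon> * w$1 + w$2) / 2),
                 (- \<epsilon> * u$1 + u$2) / 2 + \<beta> * u$3])"

definition Phi_tilde :: "real \<Rightarrow> real \<Rightarrow> real \<Rightarrow> real^3 \<Rightarrow> real" where
  "Phi_tilde \<epsilon> c0 c1 u = 2 * \<epsilon> * u$3 + c1 * exp (\<epsilon> * u$3) + c0"

end

(* The components of the metric depend only on t = u_3. With b = G_13, c = G_23 one has
   b - eps c = E := v exp (eps t) and det G = - G_11 E^2 = - Q v^2. As the upper left block of G
   is degenerate, G^33 = 0, so dt is null, and the only nonzero Gamma^3_ij is Gamma^3_33 = eps.
   The Ricci tensor and the Hessian of the dilaton therefore both reduce to the component
   33, where each equals -2, and every contraction with the inverse metric vanishes. *)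
theory Submission
  imports Defs
begin

section \<open>Partial derivatives and smooth functions\<close>

lemma pd_has_derivative:
  assumes "(f has_derivative D) (at u)"
  shows "pd i f u = D (axis i 1)"
  using frechet_derivative_at[OF assms] by (simp add: pd_def)

lemma pd_const [simp]: "pd i (\<lambda>u. c) = (\<lambda>u. 0)"
  by (rule ext) (simp add: pd_has_derivative[OF has_derivative_const])

text \<open>Chain rule through the coordinate projection. Every field differentiated later depends
  on \<open>u $ 3\<close> alone, so this turns each partial derivative into an ordinary one.\<close>

lemma pd_coordinate:
  fixes u :: "real^'n::finite"
  assumes "(g has_real_derivative g') (at (u $ j))"
  shows "pd i (\<lambda>x. g (x $ j)) u = (if i = j then g' else 0)"
proof -
  have "((\<lambda>x. x $ j) has_derivative (\<lambda>h. h $ j)) (at u)"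
    by (rule bounded_linear.has_derivative[OF bounded_linear_vec_nth]) (rule has_derivative_ident)
  then have "((\<lambda>x. g (x $ j)) has_derivative (\<lambda>h. h $ j * g')) (at u)"
    by (rule DERIV_compose_FDERIV[where g = "\<lambda>x. x $ j" and f = g, OF assms])
  from pd_has_derivative[OF this] show ?thesis
    by (simp add: axis_def)
qed

lemma pd_coordinate_other:
  fixes u :: "real^'n::finite"
  assumes "i \<noteq> j" "g differentiable at (u $ j)"
  shows "pd i (\<lambda>x. g (x $ j)) u = 0"
  using assms pd_coordinate[of g _ u j i] by (auto simp: real_differentiable_def)

lemma Ck_const: "Ck k (\<lambda>u. c)"
  by (induction k arbitrary: c) auto

lemma Ck_component: "Ck k (\<lambda>u. u $ j)"
proof (cases k)
  case 0
  then show ?thesis by (auto intro: continuous_intros)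
next
  case (Suc m)
  have "pd i (\<lambda>u. u $ j) = (\<lambda>u. if i = j then 1 else 0)" for i
    using pd_coordinate[where g = "\<lambda>x. x", OF DERIV_ident, of i j] by (intro ext) simp
  moreover have "(\<lambda>u. u $ j) differentiable_on UNIV"
    by (intro bounded_linear_imp_differentiable_on bounded_linear_vec_nth)
  ultimately show ?thesis
    using Suc by (auto intro: Ck_const)
qed

text \<open>The product rule and the chain rule for \<open>exp\<close> leave undifferentiated
  factors next to partial derivatives; this lowers those factors to the order of the induction
  hypothesis.\<close>

lemma Ck_SucD: "Ck (Suc k) f \<Longrightarrow> Ck k f"
  by (induction k arbitrary: f) (auto intro: differentiable_imp_continuous_on)

lemma has_derivative_frechet:
  assumes "f differentiable_on UNIV"
  shows "(f has_derivative frechet_derivative f (at u)) (at u)"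
  using assms by (simp add: differentiable_on_def frechet_derivative_works)

lemma Ck_add: "Ck k f \<Longrightarrow> Ck k g \<Longrightarrow> Ck k (\<lambda>u. f u + g u)"
proof (induction k arbitrary: f g)
  case 0
  then show ?case by (auto intro: continuous_intros)
next
  case (Suc k)
  have "pd i (\<lambda>u. f u + g u) = (\<lambda>u. pd i f u + pd i g u)" for i
    using Suc.prems
    by (intro ext, subst pd_has_derivative[OF has_derivative_add[OF has_derivative_frechet has_derivative_frechet]])
      (auto simp: pd_def)
  then show ?case
    using Suc by (auto intro: differentiable_on_add)
qed

lemma Ck_mult: "Ck k f \<Longrightarrow> Ck k g \<Longrightarrow> Ck k (\<lambda>u. f u * g u)"
proof (induction k arbitrary: f g)
  case 0
  then show ?case by (auto intro: continuous_intros)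
next
  case (Suc k)
  have "pd i (\<lambda>u. f u * g u) = (\<lambda>u. f u * pd i g u + pd i f u * g u)" for i
    using Suc.prems
    by (intro ext, subst pd_has_derivative[OF has_derivative_mult[OF has_derivative_frechet has_derivative_frechet]])
      (auto simp: pd_def)
  then show ?case
    using Suc Suc.prems[THEN Ck_SucD] by (auto intro!: differentiable_on_mult Ck_add)
qed

lemma Ck_exp: "Ck k f \<Longrightarrow> Ck k (\<lambda>u. exp (f u))"
proof (induction k arbitrary: f)
  case 0
  then show ?case by (auto intro: continuous_intros)
next
  case (Suc k)
  have der: "((\<lambda>u. exp (f u)) has_derivative (\<lambda>h. frechet_derivative f (at u) h * exp (f u))) (at u)" for u
    using Suc.prems
    by (intro DERIV_compose_FDERIV[OF DERIV_exp] has_derivative_frechet) auto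
  have "pd i (\<lambda>u. exp (f u)) = (\<lambda>u. pd i f u * exp (f u))" for i
    by (intro ext, subst pd_has_derivative[OF der]) (simp add: pd_def)
  moreover have "(\<lambda>u. exp (f u)) differentiable_on UNIV"
    using der by (auto simp: differentiable_on_def differentiable_def)
  ultimately show ?case
    using Suc.IH Suc.prems Ck_SucD[OF Suc.prems] by (auto intro!: Ck_mult)
qed

lemma smooth_const [simp, intro]: "smooth (\<lambda>u. c)"
  by (simp add: smooth_def Ck_const)

lemma smooth_component [intro]: "smooth (\<lambda>u. u $ j)"
  by (simp add: smooth_def Ck_component)

lemma smooth_add [intro]: "smooth f \<Longrightarrow> smooth g \<Longrightarrow> smooth (\<lambda>u. f u + g u)"
  by (simp add: smooth_def Ck_add)

lemma smooth_mult [intro]: "smooth f \<Longrightarrow> smooth g \<Longrightarrow> smooth (\<lambda>u. f u * g u)"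
  by (simp add: smooth_def Ck_mult)

lemma smooth_exp [intro]: "smooth f \<Longrightarrow> smooth (\<lambda>u. exp (f u))"
  by (simp add: smooth_def Ck_exp)

lemma smooth_minus [intro]: "smooth f \<Longrightarrow> smooth (\<lambda>u. - f u)"
  using smooth_mult[of "\<lambda>u. -1" f] by simp

lemma smooth_diff [intro]: "smooth f \<Longrightarrow> smooth g \<Longrightarrow> smooth (\<lambda>u. f u - g u)"
  using smooth_add[of f "\<lambda>u. - g u"] smooth_minus[of g] by simp

lemma smooth_divide_const [intro]: "smooth f \<Longrightarrow> smooth (\<lambda>u. f u / c)"
  unfolding divide_inverse by (intro smooth_mult smooth_const)

lemma smooth_cosh [intro]: "smooth f \<Longrightarrow> smooth (\<lambda>u. cosh (f u))"
  unfolding cosh_field_def by (intro smooth_divide_const smooth_add smooth_exp smooth_minus)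

lemma smooth_sinh [intro]: "smooth f \<Longrightarrow> smooth (\<lambda>u. sinh (f u))"
  unfolding sinh_field_def by (intro smooth_divide_const smooth_diff smooth_exp smooth_minus)

section \<open>Curvature of the transformed metric\<close>

locale transformed_metric =
  fixes \<epsilon> Q V H J :: real
  assumes eps: "\<epsilon> = 1 \<or> \<epsilon> = -1"
    and Q_nz: "Q \<noteq> 0"
    and v_nz: "V - \<epsilon> * H \<noteq> 0"
begin

abbreviation "G \<equiv> G_tilde \<epsilon> Q V H J"

section \<open>Metric entries as functions of one variable, with their derivatives\<close>

definition a :: "real \<Rightarrow> real" where "a t = Q * exp (-2 * \<epsilon> * t)"

definition b :: "real \<Rightarrow> real" where
  "b t = V * cosh t - H * sinh t + Q * ((\<epsilon> * V - H) / 2) * t * exp (- t)"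

definition c :: "real \<Rightarrow> real" where
  "c t = H * cosh t - V * sinh t + Q * ((V - \<epsilon> * H) / 2) * t * exp (- t)"

definition d :: "real \<Rightarrow> real" where "d t = J - Q * (V - \<epsilon> * H)^2 * t^2"

definition E :: "real \<Rightarrow> real" where "E t = (V - \<epsilon> * H) * exp (\<epsilon> * t)"

definition b' :: "real \<Rightarrow> real" where
  "b' t = V * sinh t - H * cosh t + Q * ((\<epsilon> * V - H) / 2) * (1 - t) * exp (- t)"

definition c' :: "real \<Rightarrow> real" where
  "c' t = H * sinh t - V * cosh t + Q * ((V - \<epsilon> * H) / 2) * (1 - t) * exp (- t)"

definition d' :: "real \<Rightarrow> real" where "d' t = - 2 * Q * (V - \<epsilon> * H)^2 * t"

lemma G_nth:
  "G u $ 1 $ 1 = a (u $ 3)" "G u $ 1 $ 2 = \<epsilon> * a (u $ 3)" "G u $ 1 $ 3 = b (u $ 3)"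
  "G u $ 2 $ 1 = \<epsilon> * a (u $ 3)" "G u $ 2 $ 2 = a (u $ 3)" "G u $ 2 $ 3 = c (u $ 3)"
  "G u $ 3 $ 1 = b (u $ 3)" "G u $ 3 $ 2 = c (u $ 3)" "G u $ 3 $ 3 = d (u $ 3)"
  by (simp_all add: G_tilde_def Let_def a_def b_def c_def d_def)

lemma eps_sq [simp]: "\<epsilon> * \<epsilon> = 1" "\<epsilon> * (\<epsilon> * x) = x"
  using eps by auto

lemma a_nz [simp]: "a t \<noteq> 0"
  using Q_nz by (simp add: a_def)

lemma E_nz [simp]: "E t \<noteq> 0"
  using v_nz by (simp add: E_def)

text \<open>The \<open>t * exp (- t)\<close> terms cancel because
  \<open>\<epsilon> * (V - \<epsilon> * H) = \<epsilon> * V - H\<close>, and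
  \<open>cosh t + \<epsilon> * sinh t = exp (\<epsilon> * t)\<close>. Used to eliminate
  \<open>b\<close>, it makes the later identities rational in the remaining entries.\<close>

lemma b_eq: "b t = \<epsilon> * c t + E t"
  using eps by (auto simp: b_def c_def E_def cosh_field_def sinh_field_def field_simps)

lemma b'_eq: "b' t = \<epsilon> * c' t + \<epsilon> * E t"
  using eps by (auto simp: b'_def c'_def E_def cosh_field_def sinh_field_def field_simps)

lemma a_deriv: "(a has_real_derivative - 2 * \<epsilon> * a t) (at t)"
  unfolding a_def by (auto intro!: derivative_eq_intros)

lemma E_deriv: "(E has_real_derivative \<epsilon> * E t) (at t)"
  unfolding E_def by (auto intro!: derivative_eq_intros)

lemma b_deriv: "(b has_real_derivative b' t) (at t)"
  unfolding b_def b'_def by (rule derivative_eq_intros refl | simp)+ (simp add: field_simps)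

lemma c_deriv: "(c has_real_derivative c' t) (at t)"
  unfolding c_def c'_def by (rule derivative_eq_intros refl | simp)+ (simp add: field_simps)

lemma d_deriv: "(d has_real_derivative d' t) (at t)"
  unfolding d_def d'_def by (auto intro!: derivative_eq_intros simp: algebra_simps)

lemmas derivs = a_deriv b_deriv c_deriv d_deriv E_deriv

section \<open>Inverse metric\<close>

definition G_inv :: "real \<Rightarrow> real^3^3" where
  "G_inv t = vector
    [vector [((c t)^2 / a t - d t) / (E t)^2, (\<epsilon> * d t - b t * c t / a t) / (E t)^2, 1 / E t],
     vector [(\<epsilon> * d t - b t * c t / a t) / (E t)^2, ((b t)^2 / a t - d t) / (E t)^2, - \<epsilon> / E t],
     vector [1 / E t, - \<epsilon> / E t, 0]]"

text \<open>\<open>G_inv\<close> is the adjugate divided by the determinant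
  \<open>- a * E^2\<close>, simplified by \<open>b - \<epsilon> * c = E\<close>. Its zero corner is
  the minor of the degenerate upper left block.\<close>

lemma G_mult_G_inv: "G u ** G_inv (u $ 3) = mat 1"
  by (auto simp: vec_eq_iff forall_3 matrix_matrix_mult_def sum_3 G_nth G_inv_def mat_def b_eq
      field_simps power2_eq_square)

lemma G_invertible: "invertible (G u)"
  using G_mult_G_inv matrix_left_right_inverse unfolding invertible_def by blast

text \<open>\<open>matrix_inv\<close> is a choice of two-sided inverse; as a left inverse it must
  agree with the right inverse \<open>G_inv\<close>.\<close>

lemma matrix_inv_G: "matrix_inv (G u) = G_inv (u $ 3)"
proof -
  have "matrix_inv (G u) ** G u = mat 1"
    using someI_ex[OF G_invertible[unfolded invertible_def]] by (simp add: matrix_inv_def)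
  then have "matrix_inv (G u) ** (G u ** G_inv (u $ 3)) = G_inv (u $ 3)"
    by (simp add: matrix_mul_assoc)
  then show ?thesis
    by (simp add: G_mult_G_inv)
qed

lemma ginv_G:
  "ginv G 1 1 u = ((c (u$3))^2 / a (u$3) - d (u$3)) / (E (u$3))^2"
  "ginv G 1 2 u = (\<epsilon> * d (u$3) - b (u$3) * c (u$3) / a (u$3)) / (E (u$3))^2"
  "ginv G 1 3 u = 1 / E (u$3)"
  "ginv G 2 1 u = (\<epsilon> * d (u$3) - b (u$3) * c (u$3) / a (u$3)) / (E (u$3))^2"
  "ginv G 2 2 u = ((b (u$3))^2 / a (u$3) - d (u$3)) / (E (u$3))^2"
  "ginv G 2 3 u = - \<epsilon> / E (u$3)"
  "ginv G 3 1 u = 1 / E (u$3)"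
  "ginv G 3 2 u = - \<epsilon> / E (u$3)"
  "ginv G 3 3 u = 0"
  by (simp_all add: ginv_def matrix_inv_G G_inv_def)

lemma pd_G:
  "pd i (\<lambda>x. a (x $ 3)) u = (if i = 3 then - 2 * \<epsilon> * a (u $ 3) else 0)"
  "pd i (\<lambda>x. \<epsilon> * a (x $ 3)) u = (if i = 3 then - 2 * a (u $ 3) else 0)"
  "pd i (\<lambda>x. b (x $ 3)) u = (if i = 3 then b' (u $ 3) else 0)"
  "pd i (\<lambda>x. c (x $ 3)) u = (if i = 3 then c' (u $ 3) else 0)"
  "pd i (\<lambda>x. d (x $ 3)) u = (if i = 3 then d' (u $ 3) else 0)"
  using pd_coordinate[where g = "\<lambda>t. \<epsilon> * a t", OF DERIV_cmult[OF a_deriv], of i]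
  by (simp_all add: pd_coordinate[OF a_deriv] pd_coordinate[OF b_deriv] pd_coordinate[OF c_deriv]
      pd_coordinate[OF d_deriv] flip: mult.assoc)

section \<open>Christoffel symbols\<close>

lemmas christoffel_unfold =
  christoffel_def sum_3 G_nth pd_G ginv_G

text \<open>Raising with row 3 of the inverse takes the combination (row 1 -
  \<open>\<epsilon>\<close> row 2) / \<open>E\<close> of the lowered symbols. The same combination
  of rows of the metric is \<open>(0, 0, E)\<close>, so only its last entry has a nonzero
  derivative, and \<open>E' / E = \<epsilon>\<close>.\<close>

lemma christoffel_G_3:
  "christoffel G 3 i j = (\<lambda>u. if i = 3 \<and> j = 3 then \<epsilon> else 0)"
proof (rule ext)
  fix u
  show "christoffel G 3 i j u = (if i = 3 \<and> j = 3 then \<epsilon> else 0)"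
    using exhaust_3[of i] exhaust_3[of j]
    by (elim disjE) (simp_all add: christoffel_unfold b'_eq field_simps)
qed

lemma christoffel_G_1:
  "christoffel G 1 1 1 = (\<lambda>u. \<epsilon> * a (u$3) / E (u$3))"
  "christoffel G 1 1 2 = (\<lambda>u. a (u$3) / E (u$3))"
  "christoffel G 1 2 1 = (\<lambda>u. a (u$3) / E (u$3))"
  "christoffel G 1 2 2 = (\<lambda>u. \<epsilon> * a (u$3) / E (u$3))"
  "christoffel G 1 1 3 = (\<lambda>u. c (u$3) / E (u$3))"
  "christoffel G 1 3 1 = (\<lambda>u. c (u$3) / E (u$3))"
  "christoffel G 1 2 3 = (\<lambda>u. \<epsilon> * c (u$3) / E (u$3))"
  "christoffel G 1 3 2 = (\<lambda>u. \<epsilon> * c (u$3) / E (u$3))"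
  by (simp_all add: fun_eq_iff christoffel_unfold) (simp_all add: b_eq field_simps power2_eq_square)

lemma christoffel_G_2:
  "christoffel G 2 1 1 = (\<lambda>u. - a (u$3) / E (u$3))"
  "christoffel G 2 1 2 = (\<lambda>u. - \<epsilon> * a (u$3) / E (u$3))"
  "christoffel G 2 2 1 = (\<lambda>u. - \<epsilon> * a (u$3) / E (u$3))"
  "christoffel G 2 2 2 = (\<lambda>u. - a (u$3) / E (u$3))"
  "christoffel G 2 1 3 = (\<lambda>u. - b (u$3) / E (u$3))"
  "christoffel G 2 3 1 = (\<lambda>u. - b (u$3) / E (u$3))"
  "christoffel G 2 2 3 = (\<lambda>u. - \<epsilon> * b (u$3) / E (u$3))"
  "christoffel G 2 3 2 = (\<lambda>u. - \<epsilon> * b (u$3) / E (u$3))"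
  by (simp_all add: fun_eq_iff christoffel_unfold) (simp_all add: b_eq field_simps power2_eq_square)

lemma christoffel_G_133:
  "christoffel G 1 3 3 = (\<lambda>u. (((c (u$3))^2 / a (u$3) - d (u$3)) / (E (u$3))^2) * b' (u$3)
     + ((\<epsilon> * d (u$3) - b (u$3) * c (u$3) / a (u$3)) / (E (u$3))^2) * c' (u$3)
     + d' (u$3) / (2 * E (u$3)))"
  by (simp add: fun_eq_iff christoffel_unfold) (simp add: field_simps)

lemma christoffel_G_233:
  "christoffel G 2 3 3 = (\<lambda>u. ((\<epsilon> * d (u$3) - b (u$3) * c (u$3) / a (u$3)) / (E (u$3))^2) * b' (u$3)
     + (((b (u$3))^2 / a (u$3) - d (u$3)) / (E (u$3))^2) * c' (u$3)
     - \<epsilon> * d' (u$3) / (2 * E (u$3)))"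
  by (simp add: fun_eq_iff christoffel_unfold) (simp add: field_simps)

section \<open>Derivatives of the Christoffel symbols and the Ricci tensor\<close>

lemma differentiable_coefficients [derivative_intros]:
  "a differentiable at t" "b differentiable at t" "c differentiable at t" "d differentiable at t"
  "E differentiable at t" "b' differentiable at t" "c' differentiable at t" "d' differentiable at t"
proof -
  show "b' differentiable at t"
    unfolding b'_def real_differentiable_def by (rule exI) (rule derivative_eq_intros refl | simp)+
  show "c' differentiable at t"
    unfolding c'_def real_differentiable_def by (rule exI) (rule derivative_eq_intros refl | simp)+
  show "d' differentiable at t"
    unfolding d'_def real_differentiable_def by (rule exI) (rule derivative_eq_intros refl | simp)+
qed (unfold real_differentiable_def, (blast intro: derivs)+)

text \<open>The long formulas for \<open>Gamma^1_33\<close> and \<open>Gamma^2_33\<close> serve only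
  to show that these are differentiable functions of \<open>u $ 3\<close>: Ricci differentiates them
  only along directions 1 and 2 respectively.\<close>

lemma pd_christoffel_33:
  "pd 1 (christoffel G 1 3 3) u = 0" "pd 2 (christoffel G 2 3 3) u = 0"
  unfolding christoffel_G_133 christoffel_G_233
  by (rule pd_coordinate_other, simp, intro derivative_intros, simp_all)+

text \<open>Since \<open>E' = \<epsilon> * E\<close>, the quotient rule keeps the single denominator
  \<open>E\<close>. The numerators that occur are multiples of \<open>a\<close>, \<open>b\<close>
  and \<open>c\<close>.\<close>

lemma deriv_over_E:
  assumes "(f has_real_derivative f') (at t)"
  shows "((\<lambda>t. f t / E t) has_real_derivative (f' - \<epsilon> * f t) / E t) (at t)"
  by (rule DERIV_cong[OF DERIV_divide[OF assms E_deriv E_nz]]) (simp add: divide_simps, simp add: algebra_simps)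

lemmas pd_over_E =
  pd_coordinate[OF deriv_over_E[OF a_deriv]]
  pd_coordinate[OF deriv_over_E[OF DERIV_minus[OF a_deriv]]]
  pd_coordinate[OF deriv_over_E[OF DERIV_cmult[OF a_deriv]]]
  pd_coordinate[OF deriv_over_E[OF DERIV_minus[OF b_deriv]]]
  pd_coordinate[OF deriv_over_E[OF DERIV_cmult[OF b_deriv]]]
  pd_coordinate[OF deriv_over_E[OF c_deriv]]
  pd_coordinate[OF deriv_over_E[OF DERIV_cmult[OF c_deriv]]]

text \<open>The determinant is constant, so the traces \<open>Gamma^k_km\<close> vanish, and so does
  the divergence \<open>d_k Gamma^k_ij\<close>; what remains is
  \<open>- Gamma^k_jm Gamma^m_ki\<close>. For \<open>i = j = 3\<close> this is
  \<open>- ((b - \<epsilon> * c)^2 / E^2 + \<epsilon>^2) = - 2\<close>, and the other components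
  cancel.\<close>

lemma ricci_G: "ricci G i j u = (if i = 3 \<and> j = 3 then - 2 else 0)"
  using exhaust_3[of i] exhaust_3[of j]
  by (elim disjE; hypsubst)
    \<comment> \<open>\<open>Gamma^1_33\<close> and \<open>Gamma^2_33\<close> stay unexpanded: in
      products they meet only factors that vanish or cancel, so \<open>d\<close> never
      enters.\<close>
    (unfold ricci_def riemann_def sum_3 christoffel_G_1 christoffel_G_2 christoffel_G_3
      pd_over_E pd_christoffel_33,
     simp_all add: b_eq b'_eq, simp_all add: divide_simps, simp_all add: algebra_simps)

lemma scalar_curvature_G: "scalar_curvature G u = 0"
  by (simp add: scalar_curvature_def sum_3 ricci_G ginv_G)

lemma pseudo_riemannian_G: "pseudo_riemannian_metric G"
proof -
  have "smooth (\<lambda>u. G u $ i $ j)" for i j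
    using exhaust_3[of i] exhaust_3[of j]
    by (elim disjE; simp add: G_tilde_def Let_def power2_eq_square; 
        intro smooth_add smooth_diff smooth_divide_const smooth_mult smooth_exp smooth_cosh smooth_sinh smooth_minus smooth_const smooth_component)
  then show ?thesis
    by (simp add: pseudo_riemannian_metric_def G_invertible vec_eq_iff forall_3 transpose_def G_nth)
qed

section \<open>The dilaton and the beta equations\<close>

lemma pd_Phi_tilde:
  "pd i (Phi_tilde \<epsilon> c0 c1) = (\<lambda>u. if i = 3 then 2 * \<epsilon> + \<epsilon> * c1 * exp (\<epsilon> * u$3) else 0)"
proof (rule ext)
  fix u :: "real^3"
  have "((\<lambda>t. 2 * \<epsilon> * t + c1 * exp (\<epsilon> * t) + c0) has_real_derivative
      2 * \<epsilon> + \<epsilon> * c1 * exp (\<epsilon> * u$3)) (at (u$3))"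
    by (auto intro!: derivative_eq_intros)
  from pd_coordinate[OF this, of i]
  show "pd i (Phi_tilde \<epsilon> c0 c1) u = (if i = 3 then 2 * \<epsilon> + \<epsilon> * c1 * exp (\<epsilon> * u$3) else 0)"
    by (simp add: Phi_tilde_def[abs_def])
qed

text \<open>For a function \<open>f\<close> of \<open>t = u $ 3\<close> the Hessian has only the
  component \<open>f'' - \<epsilon> * f'\<close>. It annihilates \<open>exp (\<epsilon> * t)\<close>
  and constants, which leaves \<open>c0\<close> and \<open>c1\<close> free, and maps
  \<open>2 * \<epsilon> * t\<close> to \<open>- 2\<close>.\<close>

lemma hess_Phi_tilde:
  "hess G (Phi_tilde \<epsilon> c0 c1) i j u = (if i = 3 \<and> j = 3 then - 2 else 0)"
proof -
  have "((\<lambda>t. 2 * \<epsilon> + \<epsilon> * c1 * exp (\<epsilon> * t)) has_real_derivative c1 * exp (\<epsilon> * u$3)) (at (u$3))"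
    by (auto intro!: derivative_eq_intros)
  note pd2 = pd_coordinate[OF this]
  show ?thesis
    by (cases "j = 3") (simp_all add: hess_def pd_Phi_tilde sum_3 christoffel_G_3 pd2, simp add: algebra_simps)
qed

lemma beta_equations_G: "beta_equations G (Phi_tilde \<epsilon> c0 c1) (\<lambda>i j k u. 0)"
proof -
  have "smooth (Phi_tilde \<epsilon> c0 c1)"
    unfolding Phi_tilde_def[abs_def]
    by (intro smooth_add smooth_mult smooth_exp smooth_const smooth_component)
  then show ?thesis
    \<comment> \<open>In the scalar equation the Hessian and the squared gradient are contracted
      only with \<open>ginv G 3 3\<close>, which is zero.\<close>
    by (simp add: beta_equations_def pseudo_riemannian_G three_form_def ricci_G hess_Phi_tilde
        scalar_curvature_G cov3_def sum_3 pd_Phi_tilde ginv_G)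
qed

end

section \<open>Dependence on the auxiliary coordinates\<close>

lemma Phi_U_y_coords:
  "Phi_U q v c0 c1 0 0 (y_coords \<epsilon> Q V H J u w) = Phi_tilde \<epsilon> c0 c1 u"
  by (simp add: Phi_U_def y_coords_def Phi_tilde_def Let_def)

text \<open>The auxiliary coordinates enter only through \<open>y $ 2\<close>, in which
  \<open>Phi_U\<close> is a quadratic polynomial; independence kills its nonconstant
  coefficients.\<close>

lemma Phi_U_independent_iff:
  assumes "q \<noteq> 0" "v \<noteq> 0"
  shows "(\<forall>u w w'. Phi_U q v c0 c1 c2 c3 (y_coords \<epsilon> Q V H J u w)
                 = Phi_U q v c0 c1 c2 c3 (y_coords \<epsilon> Q V H J u w'))
         \<longleftrightarrow> c2 = 0 \<and> c3 = 0" (is "?indep \<longleftrightarrow> _")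
proof
  assume indep: ?indep
  \<comment> \<open>The point \<open>vector [0, -2 * s, 0]\<close> gives \<open>y $ 2 = s\<close>.
    At \<open>u = 0\<close> also \<open>y $ 1 = 0\<close>, where the factor
    \<open>exp (- (y$1)) + y$1 - 1\<close> of the linear \<open>c3\<close> term vanishes.\<close>
  have "c2 * s + c3 * (q / (2 * v) * s^2) = 0" for s
    using indep[rule_format, of 0 "vector [0, -2 * s, 0]" 0]
    by (simp add: Phi_U_def y_coords_def Let_def algebra_simps)
  \<comment> \<open>The values at 1 and -1 separate the odd part, carrying \<open>c2\<close>, from
    the even part, carrying \<open>c3\<close>.\<close>
  from this[of 1] this[of "-1"] show "c2 = 0 \<and> c3 = 0"
    using assms by simp
qed (simp add: Phi_U_y_coords)

theorem mainTheorem2: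
  fixes \<epsilon> Q V H J q v :: real
  assumes "\<epsilon> \<in> {1, -1}"
    and "Q \<noteq> 0"
    and "V - \<epsilon> * H \<noteq> 0"
    and "q = inverse Q"
    and "v = V - \<epsilon> * H"
  shows "pseudo_riemannian_metric (G_tilde \<epsilon> Q V H J)
    \<and> (\<forall>u. \<exists>i j. ricci (G_tilde \<epsilon> Q V H J) i j u \<noteq> 0)
    \<and> (\<forall>u. scalar_curvature (G_tilde \<epsilon> Q V H J) u = 0)
    \<and> (\<forall>c0 c1 c2 c3. v * c2^2 + 2 * q * c1 * c3 = 0 \<longrightarrow>
         ((\<forall>u w w'. Phi_U q v c0 c1 c2 c3 (y_coords \<epsilon> Q V H J u w)
                   = Phi_U q v c0 c1 c2 c3 (y_coords \<epsilon> Q V H J u w'))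
            \<longleftrightarrow> c2 = 0 \<and> c3 = 0)
         \<and> (c2 = 0 \<and> c3 = 0 \<longrightarrow>
             (\<forall>u w. Phi_U q v c0 c1 c2 c3 (y_coords \<epsilon> Q V H J u w) = Phi_tilde \<epsilon> c0 c1 u)))
    \<and> (\<forall>c0 c1. beta_equations (G_tilde \<epsilon> Q V H J) (Phi_tilde \<epsilon> c0 c1) (\<lambda>i j k u. 0))"
proof -
  interpret transformed_metric \<epsilon> Q V H J
    using assms by unfold_locales auto
  have "\<exists>i j. ricci G i j u \<noteq> 0" for u
    by (intro exI[of _ 3]) (simp add: ricci_G)
  moreover have "q \<noteq> 0" "v \<noteq> 0"
    using assms by auto
  ultimately show ?thesis
    by (simp add: pseudo_riemannian_G scalar_curvature_G Phi_U_independent_iff beta_equations_G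
        Phi_U_y_coords)
qed

end
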